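(* Assume the following statement holds: for every positive integer $b$ and every subset $S\subseteq\{1,\ldots,b-1\}$ such that there is no prime number $p$ dividing $\prod_{a\in S}(b\cdot k + a)$ for every $k\in\mathbb{N}$, there exists $k\in\mathbb{N}$ such that for all $a\in\{1,\ldots,b-1\}$, $b\cdot k + a$ is prime if and only if $a\in S$. Then the language $\textsc{Primes} = \{u \in \{0,1\}^* \mid \mathrm{bin}(u) \text{ is prime}\}$ does not have subexponential alternating online state complexity, i.e. there is no function $f:\mathbb{N}\to\mathbb{N}$ with $f = o(C^n)$ for all $C>1$ such that $\textsc{Primes}\in\mathrm{Alt}(f)$.
   Context: For a word $w = w(0)w(1)\cdots w(n-1)\in\{0,1\}^*$, $\mathrm{bin}(w) = \sum_{i=0}^{n-1} w(i)2^i$ (least significant digit on the left). An alternating machine over a finite alphabet $A$ consists of a (possibly infinite) set of states $Q$, an initial state $q_0\in Q$, a transition function $\delta: Q\times A\to\mathcal{B}^+(Q)$ (positive boolean formulae over $Q$) and a set $F\subseteq Q$ of accepting states. For an input word $w$, the acceptance game $\mathcal{G}_{\mathcal{A},w}$ is played by Prover and Verifier: starting in $q_0$, the letters of $w$ are read from left to right; in state $q$ reading letter $a$, the next state is obtained from the formula $\delta(q,a)$, Prover resolving disjunctions and Verifier resolving conjunctions. Prover wins a play if it ends in a state of $F$. The word $w$ is accepted if Prover has a winning strategy; the language recognised is the set of accepted words. For $f:\mathbb{N}\to\mathbb{N}$, a language $L$ is in $\mathrm{Alt}(f)$ if there are an alternating machine recognising $L$ and a constant $C$ such that for all $n\in\mathbb{N}$,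 the number of states $q$ for which there exists a word $w$ of length at most $n$ with $q$ appearing in the game $\mathcal{G}_{\mathcal{A},w}$ is at most $C\cdot f(n)$. *)

theory Defs
  imports Complex_Main "HOL-Library.Landau_Symbols" "HOL-Computational_Algebra.Primes"
begin

datatype (pbf_states: 'q) pbf =
    State 'q
  | Conj "'q pbf" "'q pbf"
  | Disj "'q pbf" "'q pbf"

record ('q, 'a) machine =
  states :: "'q set"
  initial :: 'q
  trans :: "'q \<Rightarrow> 'a \<Rightarrow> 'q pbf"
  accepting :: "'q set"

definition alternating_machine :: "('q, 'a::finite) machine \<Rightarrow> bool" where
  "alternating_machine M \<longleftrightarrow>
     initial M \<in> states M \<and>
     (\<forall>q\<in>states M. \<forall>a. pbf_states (trans M q a) \<subseteq> states M) \<and>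
     accepting M \<subseteq> states M"

text \<open>
  A position is a formula that remains to be resolved together with the part of the
  input that remains to be read; in \<open>(State q, v)\<close> the current state is \<open>q\<close>.
\<close>

type_synonym ('q, 'a) position = "'q pbf \<times> 'a list"

inductive move :: "('q, 'a) machine \<Rightarrow> ('q, 'a) position \<Rightarrow> ('q, 'a) position \<Rightarrow> bool"
  for M :: "('q, 'a) machine" where
  read: "move M (State q, a # v) (trans M q a, v)"
| conj_left: "move M (Conj \<phi> \<psi>, v) (\<phi>, v)"
| conj_right: "move M (Conj \<phi> \<psi>, v) (\<psi>, v)"
| disj_left: "move M (Disj \<phi> \<psi>, v) (\<phi>, v)"
| disj_right: "move M (Disj \<phi> \<psi>, v) (\<psi>, v)"

text \<open>
  Prover moves from disjunctions and Verifier from conjunctions; reading a letter is a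
  forced move.
\<close>

definition prover_position :: "('q, 'a) position \<Rightarrow> bool" where
  "prover_position p \<longleftrightarrow> (\<exists>\<phi> \<psi> v. p = (Disj \<phi> \<psi>, v))"

text \<open>
  Plays may be partial. Every move shortens the remaining input or shrinks the formula, so
  there are no infinite plays, and finite lists suffice.
\<close>

definition play :: "('q, 'a) machine \<Rightarrow> 'a list \<Rightarrow> ('q, 'a) position list \<Rightarrow> bool" where
  "play M w \<pi> \<longleftrightarrow>
     \<pi> \<noteq> [] \<and> hd \<pi> = (State (initial M), w) \<and> successively (move M) \<pi>"

definition complete_play :: "('q, 'a) machine \<Rightarrow> 'a list \<Rightarrow> ('q, 'a) position list \<Rightarrow> bool" where
  "complete_play M w \<pi> \<longleftrightarrow> play M w \<pi> \<and> (\<nexists>p. move M (last \<pi>) p)"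

definition prover_wins :: "('q, 'a) machine \<Rightarrow> ('q, 'a) position list \<Rightarrow> bool" where
  "prover_wins M \<pi> \<longleftrightarrow> (\<exists>q\<in>accepting M. last \<pi> = (State q, []))"

text \<open>A strategy may depend on the whole history of the play.\<close>

type_synonym ('q, 'a) strategy = "('q, 'a) position list \<Rightarrow> ('q, 'a) position"

definition prover_strategy :: "('q, 'a) machine \<Rightarrow> 'a list \<Rightarrow> ('q, 'a) strategy \<Rightarrow> bool" where
  "prover_strategy M w \<sigma> \<longleftrightarrow>
     (\<forall>\<pi>. play M w \<pi> \<longrightarrow> prover_position (last \<pi>) \<longrightarrow> move M (last \<pi>) (\<sigma> \<pi>))"

definition consistent :: "('q, 'a) strategy \<Rightarrow> ('q, 'a) position list \<Rightarrow> bool" where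
  "consistent \<sigma> \<pi> \<longleftrightarrow>
     (\<forall>i. Suc i < length \<pi> \<longrightarrow> prover_position (\<pi> ! i) \<longrightarrow> \<pi> ! Suc i = \<sigma> (take (Suc i) \<pi>))"

definition winning_strategy :: "('q, 'a) machine \<Rightarrow> 'a list \<Rightarrow> ('q, 'a) strategy \<Rightarrow> bool" where
  "winning_strategy M w \<sigma> \<longleftrightarrow>
     prover_strategy M w \<sigma> \<and>
     (\<forall>\<pi>. complete_play M w \<pi> \<longrightarrow> consistent \<sigma> \<pi> \<longrightarrow> prover_wins M \<pi>)"

definition language :: "('q, 'a) machine \<Rightarrow> 'a list set" where
  "language M = {w. \<exists>\<sigma>. winning_strategy M w \<sigma>}"

definition appears :: "('q, 'a) machine \<Rightarrow> 'a list \<Rightarrow> 'q \<Rightarrow> bool" where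
  "appears M w q \<longleftrightarrow> (\<exists>\<pi> v. play M w \<pi> \<and> (State q, v) \<in> set \<pi>)"

definition online_states :: "('q, 'a) machine \<Rightarrow> nat \<Rightarrow> 'q set" where
  "online_states M n = {q. \<exists>w. length w \<le> n \<and> appears M w q}"

text \<open>
  The first argument of \<open>Alt\<close> only fixes the type from which states are drawn, since
  a definition cannot quantify over types.
\<close>

definition Alt :: "'q itself \<Rightarrow> (nat \<Rightarrow> nat) \<Rightarrow> 'a::finite list set set" where
  "Alt _ f = {L. \<exists>M :: ('q, 'a) machine. alternating_machine M \<and> language M = L \<and>
     (\<exists>C::real. \<forall>n. finite (online_states M n) \<and>
        real (card (online_states M n)) \<le> C * real (f n))}"

definition subexponential :: "(nat \<Rightarrow> nat) \<Rightarrow> bool" where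
  "subexponential f \<longleftrightarrow> (\<forall>C::real. C > 1 \<longrightarrow> (\<lambda>n. real (f n)) \<in> o(\<lambda>n. C ^ n))"

definition bin :: "bool list \<Rightarrow> nat" where
  "bin w = (\<Sum>i<length w. of_bool (w ! i) * 2 ^ i)"

definition PRIMES :: "bool list set" where
  "PRIMES = {u. prime (bin u)}"

end

theory Submission
  imports Defs "HOL-Number_Theory.Cong"
begin

text \<open>
  Fix a suffix \<open>v\<close>. Whether a word \<open>u\<close> of length at most \<open>n\<close> satisfies
  \<open>u @ v \<in> L\<close> depends only on which of the states reachable within \<open>n\<close> letters accept
  \<open>v\<close>. So the number of sets \<open>{u. length u \<le> n \<and> u @ v \<in> L}\<close>, as \<open>v\<close> varies, is at most
  2 to the number of those states. For the primes, \<open>bin (u @ v) = bin u + 2 ^ length u * bin v\<close>,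
  and the hypothesis turns every admissible \<open>S \<subseteq> {1..2 ^ n - 1}\<close> into such a set. Odd squares
  are always admissible: mod 2 they avoid 0, and modulo an odd prime they avoid a quadratic
  non-residue. For \<open>n = 2 * m\<close> there are \<open>2 ^ (m - 1)\<close> odd squares below \<open>2 ^ n\<close>, which gives
  at least \<open>2 ^ (m - 1)\<close> states.
\<close>

section \<open>Value of the acceptance game\<close>

primrec sat :: "('q \<Rightarrow> bool) \<Rightarrow> 'q pbf \<Rightarrow> bool" where
  "sat P (State q) = P q"
| "sat P (Conj \<phi> \<psi>) = (sat P \<phi> \<and> sat P \<psi>)"
| "sat P (Disj \<phi> \<psi>) = (sat P \<phi> \<or> sat P \<psi>)"

text \<open>Backward induction replaces strategies: the outcome from a state is evaluated from the
  remaining word alone, with no reference to the history. This is what makes two suffixes comparable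
  state by state.\<close>

primrec accepts :: "('q, 'a) machine \<Rightarrow> 'a list \<Rightarrow> 'q \<Rightarrow> bool" where
  "accepts M [] = (\<lambda>q. q \<in> accepting M)"
| "accepts M (a # v) = (\<lambda>q. sat (accepts M v) (trans M q a))"

definition winning :: "('q, 'a) machine \<Rightarrow> ('q, 'a) position \<Rightarrow> bool" where
  "winning M p \<longleftrightarrow> sat (accepts M (snd p)) (fst p)"

lemma winning_simps [simp]:
  "winning M (State q, []) \<longleftrightarrow> q \<in> accepting M"
  "winning M (State q, a # v) \<longleftrightarrow> winning M (trans M q a, v)"
  "winning M (Conj \<phi> \<psi>, v) \<longleftrightarrow> winning M (\<phi>, v) \<and> winning M (\<psi>, v)"
  "winning M (Disj \<phi> \<psi>, v) \<longleftrightarrow> winning M (\<phi>, v) \<or> winning M (\<psi>, v)"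
  by (auto simp: winning_def)

lemma move_simps [simp]:
  "move M (State q, []) p \<longleftrightarrow> False"
  "move M (State q, a # v) p \<longleftrightarrow> p = (trans M q a, v)"
  "move M (Conj \<phi> \<psi>, v) p \<longleftrightarrow> p = (\<phi>, v) \<or> p = (\<psi>, v)"
  "move M (Disj \<phi> \<psi>, v) p \<longleftrightarrow> p = (\<phi>, v) \<or> p = (\<psi>, v)"
  by (subst move.simps, fastforce)+

lemma prover_position_simps [simp]:
  "prover_position (State q, v) \<longleftrightarrow> False"
  "prover_position (Conj \<phi> \<psi>, v) \<longleftrightarrow> False"
  "prover_position (Disj \<phi> \<psi>, v) \<longleftrightarrow> True"
  by (auto simp: prover_position_def)

lemma position_cases [case_names End Read Conj Disj]:
  fixes p :: "('q, 'a) position"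
  obtains q where "p = (State q, [])"
  | q a v where "p = (State q, a # v)"
  | \<phi> \<psi> v where "p = (Conj \<phi> \<psi>, v)"
  | \<phi> \<psi> v where "p = (Disj \<phi> \<psi>, v)"
proof (cases p)
  case (Pair \<phi> v)
  then show ?thesis using that by (cases \<phi>; cases v) auto
qed

text \<open>A move either shortens the word or shrinks the formula, so the induction is
  lexicographic. The formula is arbitrary in the outer induction because reading a letter produces
  the unrelated formula \<open>trans M q a\<close>.\<close>

lemma position_induct [case_names End Read Conj Disj]:
  fixes P :: "'q pbf \<Rightarrow> 'a list \<Rightarrow> bool" and M :: "('q, 'a) machine"
  assumes "\<And>q. P (State q) []"
    and "\<And>q a v. P (trans M q a) v \<Longrightarrow> P (State q) (a # v)"
    and "\<And>\<phi> \<psi> v. P \<phi> v \<Longrightarrow> P \<psi> v \<Longrightarrow> P (Conj \<phi> \<psi>) v"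
    and "\<And>\<phi> \<psi> v. P \<phi> v \<Longrightarrow> P \<psi> v \<Longrightarrow> P (Disj \<phi> \<psi>) v"
  shows "P \<phi> v"
proof (induction v arbitrary: \<phi>)
  case Nil
  show ?case by (induction \<phi>) (auto intro: assms)
next
  case (Cons a v)
  show ?case by (induction \<phi>) (auto intro: assms Cons)
qed

lemma play_snoc:
  assumes "play M w \<pi>"
  shows "play M w (\<pi> @ [p]) \<longleftrightarrow> move M (last \<pi>) p"
  using assms by (auto simp: play_def successively_append_iff)

lemma consistent_snoc:
  assumes "consistent \<sigma> \<pi>" "\<pi> \<noteq> []" "prover_position (last \<pi>) \<Longrightarrow> p = \<sigma> \<pi>"
  shows "consistent \<sigma> (\<pi> @ [p])"
  unfolding consistent_def
proof (intro allI impI)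
  fix i assume i: "Suc i < length (\<pi> @ [p])" "prover_position ((\<pi> @ [p]) ! i)"
  show "(\<pi> @ [p]) ! Suc i = \<sigma> (take (Suc i) (\<pi> @ [p]))"
  proof (cases "Suc i < length \<pi>")
    case True
    then show ?thesis using i assms(1) by (auto simp: consistent_def nth_append)
  next
    case False
    then have l: "length \<pi> = Suc i" using i by auto
    then have "last \<pi> = \<pi> ! i" using assms(2) by (simp add: last_conv_nth)
    then show ?thesis using l i assms(3) by (auto simp: nth_append)
  qed
qed

text \<open>A strategy may consult the whole history, so the induction on the position keeps the
  consistent play leading to it arbitrary and extends that play by one move in each case.\<close>

lemma winning_strategy_imp_winning:
  assumes "winning_strategy M w \<sigma>" "play M w \<pi>" "consistent \<sigma> \<pi>" "last \<pi> = (\<phi>, v)"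
  shows "winning M (\<phi>, v)"
  using assms(2-4)
proof (induction \<phi> v arbitrary: \<pi> rule: position_induct[where M = M])
  case (End q)
  then have "prover_wins M \<pi>"
    using assms(1) by (auto simp: winning_strategy_def complete_play_def)
  then show ?case using End by (auto simp: prover_wins_def)
next
  case (Read q a v)
  have "\<pi> \<noteq> []" using Read.prems by (simp add: play_def)
  then have "consistent \<sigma> (\<pi> @ [(trans M q a, v)])"
    using Read.prems by (intro consistent_snoc) auto
  then have "winning M (trans M q a, v)"
    using Read.prems Read.IH[of "\<pi> @ [(trans M q a, v)]"] by (simp add: play_snoc)
  then show ?case by simp
next
  case (Conj \<phi> \<psi> v)
  have "\<pi> \<noteq> []" using Conj.prems by (simp add: play_def)
  then have "consistent \<sigma> (\<pi> @ [p])" for p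
    using Conj.prems by (intro consistent_snoc) auto
  then show ?case
    using Conj.prems Conj.IH(1)[of "\<pi> @ [(\<phi>, v)]"] Conj.IH(2)[of "\<pi> @ [(\<psi>, v)]"]
    by (simp add: play_snoc)
next
  case (Disj \<phi> \<psi> v)
  have ne: "\<pi> \<noteq> []" using Disj.prems by (simp add: play_def)
  have mv: "move M (last \<pi>) (\<sigma> \<pi>)"
    using assms(1) Disj.prems by (auto simp: winning_strategy_def prover_strategy_def)
  have "play M w (\<pi> @ [\<sigma> \<pi>])" "consistent \<sigma> (\<pi> @ [\<sigma> \<pi>])"
    using mv ne Disj.prems by (auto simp: play_snoc consistent_snoc)
  then show ?case
    using mv Disj.prems(3) Disj.IH(1)[of "\<pi> @ [\<sigma> \<pi>]"] Disj.IH(2)[of "\<pi> @ [\<sigma> \<pi>]"] by auto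
qed

text \<open>The implication inside \<open>SOME\<close> ensures a legal choice from lost positions
  too, since \<open>prover_strategy\<close> demands one after every play that ends in a
  disjunction.\<close>

definition greedy_strategy :: "('q, 'a) machine \<Rightarrow> ('q, 'a) strategy" where
  "greedy_strategy M \<pi> =
     (SOME p. move M (last \<pi>) p \<and> (winning M (last \<pi>) \<longrightarrow> winning M p))"

lemma greedy_strategy:
  assumes "prover_position (last \<pi>)"
  shows "move M (last \<pi>) (greedy_strategy M \<pi>)"
    and "winning M (last \<pi>) \<Longrightarrow> winning M (greedy_strategy M \<pi>)"
proof -
  have "\<exists>p. move M (last \<pi>) p \<and> (winning M (last \<pi>) \<longrightarrow> winning M p)"
    using assms by (cases "last \<pi>" rule: position_cases) auto
  from someI_ex[OF this] show "move M (last \<pi>) (greedy_strategy M \<pi>)"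
    and "winning M (last \<pi>) \<Longrightarrow> winning M (greedy_strategy M \<pi>)"
    unfolding greedy_strategy_def by auto
qed

lemma winning_greedy:
  assumes "winning M (State (initial M), w)" "play M w \<pi>" "consistent (greedy_strategy M) \<pi>"
    "i < length \<pi>"
  shows "winning M (\<pi> ! i)"
  using assms(4)
proof (induction i)
  case 0
  then show ?case using assms(1,2) by (auto simp: play_def hd_conv_nth)
next
  case (Suc i)
  then have win: "winning M (\<pi> ! i)" by simp
  have mv: "move M (\<pi> ! i) (\<pi> ! Suc i)"
    using assms(2) Suc.prems by (simp add: play_def successively_conv_nth)
  show ?case
  proof (cases "prover_position (\<pi> ! i)")
    case True
    have last: "last (take (Suc i) \<pi>) = \<pi> ! i"
      using Suc.prems by (simp add: take_Suc_conv_app_nth)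
    have "\<pi> ! Suc i = greedy_strategy M (take (Suc i) \<pi>)"
      using assms(3) Suc.prems True by (auto simp: consistent_def)
    then show ?thesis using greedy_strategy(2)[of "take (Suc i) \<pi>" M] True win last by simp
  next
    \<comment> \<open>Verifier's moves and forced moves cannot leave the winning positions.\<close>
    case False
    then show ?thesis using mv win by (cases "\<pi> ! i" rule: position_cases) auto
  qed
qed

lemma winning_strategy_greedy:
  assumes "winning M (State (initial M), w)"
  shows "winning_strategy M w (greedy_strategy M)"
  unfolding winning_strategy_def
proof (intro conjI allI impI)
  show "prover_strategy M w (greedy_strategy M)"
    by (auto simp: prover_strategy_def greedy_strategy)
next
  fix \<pi> assume \<pi>: "complete_play M w \<pi>" "consistent (greedy_strategy M) \<pi>"
  then have "play M w \<pi>" "\<pi> \<noteq> []" by (auto simp: complete_play_def play_def)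
  then have "winning M (last \<pi>)"
    using winning_greedy[OF assms _ \<pi>(2), of "length \<pi> - 1"] by (simp add: last_conv_nth)
  moreover have "\<nexists>p. move M (last \<pi>) p" using \<pi>(1) by (simp add: complete_play_def)
  ultimately show "prover_wins M \<pi>"
    by (cases "last \<pi>" rule: position_cases) (auto simp: prover_wins_def)
qed

lemma mem_language_iff: "w \<in> language M \<longleftrightarrow> winning M (State (initial M), w)"
proof
  assume "w \<in> language M"
  then obtain \<sigma> where "winning_strategy M w \<sigma>" by (auto simp: language_def)
  then show "winning M (State (initial M), w)"
    using winning_strategy_imp_winning[of M w \<sigma> "[(State (initial M), w)]"]
    by (simp add: play_def consistent_def)
next
  assume "winning M (State (initial M), w)"
  then show "w \<in> language M" using winning_strategy_greedy by (auto simp: language_def)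
qed

section \<open>Distinct suffixes and the number of states\<close>

text \<open>Until the prefix is used up, the games with suffixes \<open>v\<close> and
  \<open>v'\<close> proceed in parallel. They can differ only in the state reached at the end of the
  prefix, and that state appears in the game on \<open>w\<close>.\<close>

lemma winning_append_cong:
  assumes "play M w \<pi>" "last \<pi> = (\<phi>, u)"
    and "\<And>q. appears M w q \<Longrightarrow> accepts M v q \<longleftrightarrow> accepts M v' q"
  shows "winning M (\<phi>, u @ v) \<longleftrightarrow> winning M (\<phi>, u @ v')"
  using assms(1,2)
proof (induction \<phi> u arbitrary: \<pi> rule: position_induct[where M = M])
  case (End q)
  then have "appears M w q"
    unfolding appears_def play_def by (metis last_in_set)
  then show ?case using assms(3) by (simp add: winning_def)
next
  case (Read q a u)
  then show ?case using Read.IH[of "\<pi> @ [(trans M q a, u)]"] by (simp add: play_snoc)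
next
  case (Conj \<phi> \<psi> u)
  then show ?case
    using Conj.IH(1)[of "\<pi> @ [(\<phi>, u)]"] Conj.IH(2)[of "\<pi> @ [(\<psi>, u)]"] by (simp add: play_snoc)
next
  case (Disj \<phi> \<psi> u)
  then show ?case
    using Disj.IH(1)[of "\<pi> @ [(\<phi>, u)]"] Disj.IH(2)[of "\<pi> @ [(\<psi>, u)]"] by (simp add: play_snoc)
qed

lemma append_mem_language_cong:
  assumes "length u \<le> n"
    and "\<And>q. q \<in> online_states M n \<Longrightarrow> accepts M v q \<longleftrightarrow> accepts M v' q"
  shows "u @ v \<in> language M \<longleftrightarrow> u @ v' \<in> language M"
  unfolding mem_language_iff
proof (rule winning_append_cong)
  show "play M u [(State (initial M), u)]" by (simp add: play_def)
  show "accepts M v q \<longleftrightarrow> accepts M v' q" if "appears M u q" for q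
    using assms that unfolding online_states_def by blast
qed simp

text \<open>Choose a suffix realising each subset of \<open>U\<close> and map the subset to the set
  of online states accepting that suffix. This map is injective on \<open>Pow U\<close>; comparing
  cardinalities of power sets gives the bound.\<close>

lemma card_shattered_le_card_online_states:
  assumes fin: "finite (online_states M n)" and len: "\<And>u. u \<in> U \<Longrightarrow> length u \<le> n"
    and "finite U"
    and sh: "\<And>V. V \<subseteq> U \<Longrightarrow> \<exists>v. \<forall>u\<in>U. u @ v \<in> language M \<longleftrightarrow> u \<in> V"
  shows "card U \<le> card (online_states M n)"
proof -
  obtain g where g: "u @ g V \<in> language M \<longleftrightarrow> u \<in> V" if "V \<subseteq> U" "u \<in> U" for V u
    using sh by metis
  define h where "h V = {q \<in> online_states M n. accepts M (g V) q}" for V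
  have "inj_on h (Pow U)"
  proof (rule inj_onI)
    fix V W assume VW: "V \<in> Pow U" "W \<in> Pow U" "h V = h W"
    then have "accepts M (g V) q \<longleftrightarrow> accepts M (g W) q" if "q \<in> online_states M n" for q
      using that by (auto simp: h_def)
    then have "u \<in> V \<longleftrightarrow> u \<in> W" if "u \<in> U" for u
      using append_mem_language_cong[OF len[OF that]] g that VW(1,2) by (metis PowD)
    then show "V = W" using VW by blast
  qed
  moreover have "h ` Pow U \<subseteq> Pow (online_states M n)" by (auto simp: h_def)
  ultimately have "card (Pow U) \<le> card (Pow (online_states M n))"
    using fin by (intro card_inj_on_le) auto
  then show ?thesis using fin \<open>finite U\<close> by (simp add: card_Pow)
qed

section \<open>Binary words\<close>

lemma bin_Nil [simp]: "bin [] = 0"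
  by (simp add: bin_def)

lemma bin_Cons [simp]: "bin (x # u) = of_bool x + 2 * bin u"
  unfolding bin_def length_Cons sum.lessThan_Suc_shift
  by (simp add: sum_distrib_left mult.left_commute del: sum_of_bool_mult_eq sum_mult_of_bool_eq)

lemma bin_append: "bin (u @ v) = 2 ^ length u * bin v + bin u"
  by (induction u) (auto simp: algebra_simps)

lemma ex_bin_eq: "a < 2 ^ n \<Longrightarrow> \<exists>u. length u = n \<and> bin u = a"
proof (induction n arbitrary: a)
  case 0
  then show ?case by auto
next
  case (Suc n)
  then have "a div 2 < 2 ^ n" by (simp add: div_less_iff_less_mult mult.commute)
  then obtain u where "length u = n" "bin u = a div 2" using Suc.IH by blast
  then have "length (odd a # u) = Suc n" "bin (odd a # u) = a"
    by (simp_all add: of_bool_odd_eq_mod_2)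
  then show ?case by blast
qed

section \<open>Admissibility of odd squares\<close>

text \<open>Squaring identifies the distinct residues 1 and \<open>p - 1\<close>, so as a self-map
  of a finite set it is not surjective.\<close>

lemma ex_quadratic_nonresidue:
  fixes p :: nat
  assumes "p > 2"
  shows "\<exists>c<p. \<forall>x. x\<^sup>2 mod p \<noteq> c"
proof -
  let ?f = "\<lambda>x. x\<^sup>2 mod p"
  have "(p - 1)\<^sup>2 mod p = 1\<^sup>2 mod p"
  proof -
    have "(p - 1)\<^sup>2 = 1 + (p - 2) * p"
    proof -
      obtain k where "p = k + 2" using assms by (metis add.commute less_imp_add_positive)
      then show ?thesis by (simp add: power2_eq_square algebra_simps)
    qed
    then have "(p - 1)\<^sup>2 mod p = (1 + (p - 2) * p) mod p" by (simp only:)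
    also have "\<dots> = 1\<^sup>2 mod p" by (simp only: mod_mult_self1 power_one)
    finally show ?thesis .
  qed
  then have "\<not> inj_on ?f {..<p}"
    using assms inj_onD[of ?f "{..<p}" "p - 1" 1] by auto
  then have "?f ` {..<p} \<noteq> {..<p}"
    by (metis eq_card_imp_inj_on finite_lessThan)
  moreover have "?f ` {..<p} \<subseteq> {..<p}" using assms by auto
  ultimately obtain c where c: "c < p" "c \<notin> ?f ` {..<p}" by auto
  have "x\<^sup>2 mod p \<noteq> c" for x
  proof -
    have "?f (x mod p) \<in> ?f ` {..<p}" using assms by (intro imageI) auto
    then show ?thesis using c(2) unfolding power_mod by blast
  qed
  then show ?thesis using c(1) by blast
qed

lemma ex_not_dvd_mult_add_square:
  fixes b p :: nat
  assumes "coprime b p" "p > 2"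
  shows "\<exists>k. \<forall>x. \<not> p dvd b * k + x\<^sup>2"
proof -
  obtain c where c: "c < p" "\<And>x. x\<^sup>2 mod p \<noteq> c" using ex_quadratic_nonresidue[OF assms(2)] by auto
  obtain y where y: "[b * y = 1] (mod p)"
    using cong_solve_coprime_nat[OF assms(1)] by auto
  \<comment> \<open>As \<open>y\<close> inverts \<open>b\<close>, the witness
    \<open>k = y * (p - c)\<close> makes \<open>b * k\<close> congruent to \<open>-c\<close>;
    divisibility would then make \<open>c\<close> a square modulo \<open>p\<close>.\<close>
  have "\<not> p dvd b * (y * (p - c)) + x\<^sup>2" for x
  proof
    assume "p dvd b * (y * (p - c)) + x\<^sup>2"
    then have "[b * y * (p - c) + x\<^sup>2 = 0] (mod p)" by (simp add: cong_0_iff ac_simps)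
    moreover have "[b * y * (p - c) + x\<^sup>2 = 1 * (p - c) + x\<^sup>2] (mod p)"
      by (intro cong_add cong_mult y cong_refl)
    ultimately have "[1 * (p - c) + x\<^sup>2 = 0] (mod p)" by (metis cong_sym cong_trans)
    then have "[1 * (p - c) + x\<^sup>2 + c = 0 + c] (mod p)" by (intro cong_add cong_refl)
    then have "[p + x\<^sup>2 = c] (mod p)" using c(1) by simp
    then show False using c by (simp add: cong_def)
  qed
  then show ?thesis by blast
qed

lemma odd_squares_admissible:
  assumes "finite S" "S \<subseteq> {x\<^sup>2 |x. odd x}" "n > 0" "prime (p::nat)"
  shows "\<exists>k. \<not> p dvd (\<Prod>a\<in>S. 2 ^ n * k + a)"
proof -
  \<comment> \<open>One \<open>k\<close> has to serve all odd squares at once; since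
    \<open>p\<close> is prime, it then divides no product of the corresponding factors.\<close>
  have "\<exists>k. \<forall>x. odd x \<longrightarrow> \<not> p dvd 2 ^ n * k + x\<^sup>2"
  proof (cases "p = 2")
    case True
    then show ?thesis using assms(3) by auto
  next
    case False
    then have "p > 2" using prime_ge_2_nat[OF assms(4)] by simp
    then have "coprime (2 ^ n) p"
      using assms(4) prime_odd_nat by auto
    then show ?thesis using ex_not_dvd_mult_add_square \<open>p > 2\<close> by blast
  qed
  then obtain k where "\<And>x. odd x \<Longrightarrow> \<not> p dvd 2 ^ n * k + x\<^sup>2" by blast
  then show ?thesis
    using assms(1,2,4) by (intro exI[of _ k]) (auto simp: prime_dvd_prod_iff)
qed

section \<open>State complexity of the primes\<close>

lemma card_online_states_PRIMES_ge:
  assumes hyp: "\<forall>(b::nat) S. b > 0 \<longrightarrow> S \<subseteq> {1..b - 1} \<longrightarrow>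
      \<not> (\<exists>p::nat. prime p \<and> (\<forall>k::nat. p dvd (\<Prod>a\<in>S. b * k + a))) \<longrightarrow>
      (\<exists>k::nat. \<forall>a\<in>{1..b - 1}. prime (b * k + a) \<longleftrightarrow> a \<in> S)"
    and "language M = PRIMES" "finite (online_states M (2 * Suc m))"
  shows "2 ^ m \<le> card (online_states M (2 * Suc m))"
proof -
  \<comment> \<open>An even exponent makes \<open>2 ^ n\<close> the square of
    \<open>2 ^ Suc m\<close>, below which lie exactly \<open>2 ^ m\<close> odd numbers.\<close>
  define n where "n = 2 * Suc m"
  define T :: "nat set" where "T = (\<lambda>y. (2 * y + 1)\<^sup>2) ` {..<2 ^ m}"
  have T_range: "T \<subseteq> {1..2 ^ n - 1}"
  proof
    fix a assume "a \<in> T"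
    then obtain y where y: "a = (2 * y + 1)\<^sup>2" "y < 2 ^ m" by (auto simp: T_def)
    then have "2 * y + 1 < 2 ^ Suc m" by simp
    then have "(2 * y + 1)\<^sup>2 < (2 ^ Suc m)\<^sup>2" by (intro power_strict_mono) auto
    also have "\<dots> = 2 ^ n" unfolding n_def by (metis mult.commute power_mult)
    finally show "a \<in> {1..2 ^ n - 1}" using y by simp
  qed
  have T_squares: "T \<subseteq> {x\<^sup>2 |x. odd x}"
  proof
    fix a assume "a \<in> T"
    then obtain y where "a = (2 * y + 1)\<^sup>2" by (auto simp: T_def)
    then show "a \<in> {x\<^sup>2 |x. odd x}" by (auto intro!: exI[of _ "2 * y + 1"])
  qed
  have card_T: "card T = 2 ^ m"
    unfolding T_def by (subst card_image) (auto simp: inj_on_def)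
  have "finite T" by (simp add: T_def)
  \<comment> \<open>Padding all words to length exactly \<open>n\<close> gives every
    \<open>word a @ v\<close> the value \<open>2 ^ n * bin v + a\<close>, with the same modulus for
    all \<open>a\<close>.\<close>
  have "\<exists>u. length u = n \<and> bin u = a" if "a \<in> T" for a
    using subsetD[OF T_range that] by (intro ex_bin_eq) auto
  then obtain word where word: "\<And>a. a \<in> T \<Longrightarrow> length (word a) = n \<and> bin (word a) = a" by metis
  have "\<exists>v. \<forall>u\<in>word ` T. u @ v \<in> language M \<longleftrightarrow> u \<in> V" if V: "V \<subseteq> word ` T" for V
  proof -
    define S where "S = {a \<in> T. word a \<in> V}"
    have "S \<subseteq> T" by (auto simp: S_def)
    then have "finite S" "S \<subseteq> {x\<^sup>2 |x. odd x}" "S \<subseteq> {1..2 ^ n - 1}"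
      using T_squares T_range \<open>finite T\<close> finite_subset by auto
    moreover have "n > 0" by (simp add: n_def)
    ultimately obtain k where k: "\<forall>a\<in>{1..2 ^ n - 1}. prime (2 ^ n * k + a) \<longleftrightarrow> a \<in> S"
      using hyp[rule_format, of "2 ^ n" S] odd_squares_admissible[of S n] by auto
    \<comment> \<open>Length \<open>k\<close> suffices for the suffix because
      \<open>k < 2 ^ k\<close>.\<close>
    obtain v where "bin v = k" using ex_bin_eq[of k k] by auto
    then have "word a @ v \<in> language M \<longleftrightarrow> word a \<in> V" if "a \<in> T" for a
      using that k T_range word[OF that] by (auto simp: assms(2) PRIMES_def bin_append S_def)
    then show ?thesis by blast
  qed
  then have "card (word ` T) \<le> card (online_states M n)"
    using word \<open>finite T\<close> assms(3) by (intro card_shattered_le_card_online_states) (auto simp: n_def)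
  moreover have "card (word ` T) = card T"
    using word by (intro card_image inj_onI) metis
  ultimately show ?thesis by (simp add: card_T n_def)
qed

lemma subexponential_eventually_less:
  assumes "subexponential f"
  shows "\<forall>\<^sub>F m in sequentially. C * real (f (2 * Suc m)) < 2 ^ m"
proof -
  \<comment> \<open>\<open>C\<close> may be negative, so it is bounded by
    \<open>\<bar>C\<bar> + 1\<close>, which is positive and cancels. The base \<open>sqrt 2\<close>
    turns the exponent \<open>2 * Suc m\<close> into \<open>2 ^ Suc m\<close>, and the factor 8
    leaves a quarter of \<open>2 ^ m\<close>.\<close>
  define D where "D = 8 * (\<bar>C\<bar> + 1)"
  have "D > 0" by (simp add: D_def)
  have "(\<lambda>n. real (f n)) \<in> o(\<lambda>n. sqrt 2 ^ n)"
    using assms by (simp add: subexponential_def)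
  from landau_o.smallD[OF this, of "1 / D"] \<open>D > 0\<close>
  obtain N where N: "\<And>n. n \<ge> N \<Longrightarrow> real (f n) \<le> sqrt 2 ^ n / D"
    by (auto simp: eventually_sequentially)
  have "C * real (f (2 * Suc m)) < 2 ^ m" if "m \<ge> N" for m
  proof -
    have "C * real (f (2 * Suc m)) \<le> (\<bar>C\<bar> + 1) * real (f (2 * Suc m))"
      by (intro mult_right_mono) auto
    also have "\<dots> \<le> (\<bar>C\<bar> + 1) * (sqrt 2 ^ (2 * Suc m) / D)"
      using that by (intro mult_left_mono N) auto
    also have "\<dots> = 2 ^ Suc m / 8"
      unfolding power_mult D_def by (simp add: field_simps)
    also have "\<dots> < 2 ^ m" by simp
    finally show ?thesis .
  qed
  then show ?thesis by (auto simp: eventually_sequentially)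
qed

theorem theorem9:
  assumes "\<forall>(b::nat) S. b > 0 \<longrightarrow> S \<subseteq> {1..b - 1} \<longrightarrow>
      \<not> (\<exists>p::nat. prime p \<and> (\<forall>k::nat. p dvd (\<Prod>a\<in>S. b * k + a))) \<longrightarrow>
      (\<exists>k::nat. \<forall>a\<in>{1..b - 1}. prime (b * k + a) \<longleftrightarrow> a \<in> S)"
  shows "\<not> (\<exists>f::nat \<Rightarrow> nat. subexponential f \<and> PRIMES \<in> Alt TYPE('q) f)"
proof
  assume "\<exists>f::nat \<Rightarrow> nat. subexponential f \<and> PRIMES \<in> Alt TYPE('q) f"
  then obtain f :: "nat \<Rightarrow> nat" and M :: "('q, bool) machine" and C :: real
    where f: "subexponential f" and M: "language M = PRIMES"
      and bound: "\<And>n. finite (online_states M n) \<and> real (card (online_states M n)) \<le> C * real (f n)"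
    unfolding Alt_def by blast
  obtain m where "C * real (f (2 * Suc m)) < 2 ^ m"
    using eventually_happens[OF subexponential_eventually_less[OF f]] by auto
  moreover have "2 ^ m \<le> real (card (online_states M (2 * Suc m)))"
    using card_online_states_PRIMES_ge[OF assms M] bound
    by (metis of_nat_le_iff of_nat_numeral of_nat_power)
  ultimately show False using bound[of "2 * Suc m"] by linarith
qed

end
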